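(* Let $S_K$ be any concave entropy function. The firm subadditivity condition for $S_K$ implies and strengthens the subadditivity condition: if $S_K$ is firmly subadditive, i.e. $S_K(a:b)\geq \chi_K(P_a,b)$ for all bipartite systems $ab$ (all dimensions), all density operators $\rho_{ab}$ and all POVMs $P_a$ on $a$, then $S_K$ is also subadditive, i.e. $S_K(\rho_a)+S_K(\rho_b)\geq S_K(\rho_{ab})$, equivalently $S_K(a:b)\geq 0$, for all bipartite $\rho_{ab}$. (The lower bound is a strengthening in the sense that $\chi_K(P_a,b)\geq 0$ for all $\rho_{ab}$ and all $P_a$.)
   Context: All Hilbert spaces are finite-dimensional. An entropy function $S_K$ assigns a real number $S_K(\rho)$ to each density operator $\rho$ on each finite-dimensional Hilbert space, depending only on the non-zero spectrum of $\rho$ (non-zero eigenvalues with multiplicity). It is concave: $S_K(\sum_j p_j\rho_j)\ge\sum_j p_jS_K(\rho_j)$ for probabilities $p_j$ and density operators $\rho_j$ on a common space. For a density operator $\rho_{ab}$ on $\mathcal{H}_a\otimes\mathcal{H}_b$, $\rho_a=\mathrm{Tr}_b(\rho_{ab})$ and $\rho_b=\mathrm{Tr}_a(\rho_{ab})$, and $S_K(a:b)=S_K(\rho_a)+S_K(\rho_b)-S_K(\rho_{ab})$. A POVM $P_a=\{P_{aj}\}$ on $a$ is a finite collection of positive semidefinite operators on $\mathcal{H}_a$ with $\sum_j P_{aj}=I_a$. The Holevo quantity is $\chi_K(P_a,b)=S_K(\rho_b)-\sum_j p_jS_K(\rho_{bj})$, where $p_j=\mathrm{Tr}(P_{aj}\rho_a)$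 and $p_j\rho_{bj}=\mathrm{Tr}_a[(P_{aj}\otimes I_b)\rho_{ab}]$ (terms with $p_j=0$ are omitted). *)

theory Defs
  imports "Jordan_Normal_Form.Char_Poly" "Jordan_Normal_Form.Conjugate"
begin

text \<open>
  Operators on an \<open>n\<close>-dimensional Hilbert space are complex \<open>n \<times> n\<close> matrices. The composite of
  systems \<open>a\<close>, \<open>b\<close> of dimensions \<open>m\<close>, \<open>n\<close> is \<open>m * n\<close>-dimensional; the product basis vector
  \<open>e\<^sub>i \<otimes> f\<^sub>k\<close> has index \<open>i * n + k\<close>.
\<close>

definition mat_trace :: "complex mat \<Rightarrow> complex" where
  "mat_trace A = (\<Sum>i<dim_row A. A $$ (i, i))"

text \<open>
  \<open>\<ge>\<close> is the order of \<open>Complex_Order\<close>: the inner product is required to be real and nonnegative.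
  Over the complex numbers this forces \<open>A\<close> to be Hermitian.
\<close>

definition psd :: "nat \<Rightarrow> complex mat \<Rightarrow> bool" where
  "psd n A \<longleftrightarrow> A \<in> carrier_mat n n \<and> (\<forall>v \<in> carrier_vec n. (A *\<^sub>v v) \<bullet>c v \<ge> 0)"

definition density_op :: "nat \<Rightarrow> complex mat \<Rightarrow> bool" where
  "density_op n \<rho> \<longleftrightarrow> psd n \<rho> \<and> mat_trace \<rho> = 1"

definition mat_sum :: "nat \<Rightarrow> ('i \<Rightarrow> complex mat) \<Rightarrow> 'i set \<Rightarrow> complex mat" where
  "mat_sum n A J = mat n n (\<lambda>ij. \<Sum>k\<in>J. A k $$ ij)"

definition kron :: "complex mat \<Rightarrow> complex mat \<Rightarrow> complex mat" where
  "kron A B = mat (dim_row A * dim_row B) (dim_col A * dim_col B)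
     (\<lambda>(i, j). A $$ (i div dim_row B, j div dim_col B) * B $$ (i mod dim_row B, j mod dim_col B))"

definition trace_b :: "nat \<Rightarrow> nat \<Rightarrow> complex mat \<Rightarrow> complex mat" where
  "trace_b m n X = mat m m (\<lambda>(i, j). \<Sum>k<n. X $$ (i * n + k, j * n + k))"

definition trace_a :: "nat \<Rightarrow> nat \<Rightarrow> complex mat \<Rightarrow> complex mat" where
  "trace_a m n X = mat n n (\<lambda>(k, l). \<Sum>i<m. X $$ (i * n + k, i * n + l))"

text \<open>
  Multiplicities are those of the roots of the characteristic polynomial; for Hermitian matrices
  they agree with the dimensions of the eigenspaces.
\<close>

definition nonzero_spectrum :: "complex mat \<Rightarrow> complex multiset" where
  "nonzero_spectrum A = filter_mset (\<lambda>x. x \<noteq> 0) (proots (char_poly A))"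

text \<open>
  A matrix carries its dimension, so a function on \<open>complex mat\<close> is a family of functions, one per
  dimension. Only its values on density operators are ever constrained or used.
\<close>

definition entropy_function :: "(complex mat \<Rightarrow> real) \<Rightarrow> bool" where
  "entropy_function S \<longleftrightarrow>
     (\<forall>m n \<rho> \<sigma>. density_op m \<rho> \<longrightarrow> density_op n \<sigma> \<longrightarrow>
        nonzero_spectrum \<rho> = nonzero_spectrum \<sigma> \<longrightarrow> S \<rho> = S \<sigma>)"

definition concave_entropy :: "(complex mat \<Rightarrow> real) \<Rightarrow> bool" where
  "concave_entropy S \<longleftrightarrow>
     (\<forall>n N p \<rho>. (\<forall>j<N. 0 \<le> p j) \<longrightarrow> (\<Sum>j<N. p j) = 1 \<longrightarrow> (\<forall>j<N. density_op n (\<rho> j)) \<longrightarrow>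
        S (mat_sum n (\<lambda>j. complex_of_real (p j) \<cdot>\<^sub>m \<rho> j) {..<N}) \<ge> (\<Sum>j<N. p j * S (\<rho> (j::nat))))"

definition mutual_info :: "(complex mat \<Rightarrow> real) \<Rightarrow> nat \<Rightarrow> nat \<Rightarrow> complex mat \<Rightarrow> real" where
  "mutual_info S m n \<rho> = S (trace_b m n \<rho>) + S (trace_a m n \<rho>) - S \<rho>"

text \<open>The collection is indexed by \<open>{..<N}\<close>, so repeated and zero elements are allowed.\<close>

definition povm :: "nat \<Rightarrow> nat \<Rightarrow> (nat \<Rightarrow> complex mat) \<Rightarrow> bool" where
  "povm m N P \<longleftrightarrow> (\<forall>j<N. psd m (P j)) \<and> mat_sum m P {..<N} = 1\<^sub>m m"

definition outcome_prob :: "nat \<Rightarrow> nat \<Rightarrow> complex mat \<Rightarrow> complex mat \<Rightarrow> real" where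
  "outcome_prob m n \<rho> Q = Re (mat_trace (Q * trace_b m n \<rho>))"

definition post_state :: "nat \<Rightarrow> nat \<Rightarrow> complex mat \<Rightarrow> complex mat \<Rightarrow> complex mat" where
  "post_state m n \<rho> Q =
     complex_of_real (1 / outcome_prob m n \<rho> Q) \<cdot>\<^sub>m trace_a m n (kron Q (1\<^sub>m n) * \<rho>)"

definition holevo ::
  "(complex mat \<Rightarrow> real) \<Rightarrow> nat \<Rightarrow> nat \<Rightarrow> complex mat \<Rightarrow> nat \<Rightarrow> (nat \<Rightarrow> complex mat) \<Rightarrow> real" where
  "holevo S m n \<rho> N P = S (trace_a m n \<rho>) -
     (\<Sum>j | j < N \<and> outcome_prob m n \<rho> (P j) \<noteq> 0.
        outcome_prob m n \<rho> (P j) * S (post_state m n \<rho> (P j)))"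

definition firmly_subadditive :: "(complex mat \<Rightarrow> real) \<Rightarrow> bool" where
  "firmly_subadditive S \<longleftrightarrow>
     (\<forall>m n \<rho> N P. density_op (m * n) \<rho> \<longrightarrow> povm m N P \<longrightarrow> mutual_info S m n \<rho> \<ge> holevo S m n \<rho> N P)"

definition subadditive :: "(complex mat \<Rightarrow> real) \<Rightarrow> bool" where
  "subadditive S \<longleftrightarrow>
     (\<forall>m n \<rho>. density_op (m * n) \<rho> \<longrightarrow> S (trace_b m n \<rho>) + S (trace_a m n \<rho>) \<ge> S \<rho>)"

end

theory Submission
  imports Defs
begin

text \<open>
  The unnormalised post-measurement operators \<open>T\<^sub>x = Tr\<^sub>a ((P\<^sub>x \<otimes> I) \<rho>)\<close> are positive semidefinite with
  trace \<open>p\<^sub>x\<close> and sum to \<open>\<rho>\<^sub>b\<close>, so concavity gives \<open>\<chi> \<ge> 0\<close>. Positivity of \<open>T\<^sub>x\<close> reduces to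
  \<open>Tr (A B) \<ge> 0\<close> for positive semidefinite \<open>A\<close>, \<open>B\<close>, which follows by splitting off a rank-one term
  of \<open>A\<close> and passing to its Schur complement; no spectral theorem is needed.
\<close>

section \<open>Quadratic forms and positivity\<close>

text \<open>Entries are functions on all of \<open>nat\<close> and only \<open>n\<close> bounds the
  sums, so passing to a leading principal block just lowers \<open>n\<close>; this suits the
  induction on the dimension.\<close>

definition qform :: "nat \<Rightarrow> (nat \<Rightarrow> nat \<Rightarrow> complex) \<Rightarrow> (nat \<Rightarrow> complex) \<Rightarrow> complex" where
  "qform n A v = (\<Sum>i<n. \<Sum>j<n. A i j * v j * cnj (v i))"

definition pos_form :: "nat \<Rightarrow> (nat \<Rightarrow> nat \<Rightarrow> complex) \<Rightarrow> bool" where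
  "pos_form n A \<longleftrightarrow> (\<forall>v. 0 \<le> qform n A v)"

lemma psd_iff_pos_form:
  "psd n A \<longleftrightarrow> A \<in> carrier_mat n n \<and> pos_form n (\<lambda>i j. A $$ (i, j))"
proof (cases "A \<in> carrier_mat n n")
  case True
  have form: "(A *\<^sub>v vec n f) \<bullet>c vec n f = qform n (\<lambda>i j. A $$ (i, j)) f" for f
    using True
    by (auto simp: qform_def scalar_prod_def sum_distrib_right atLeast0LessThan
        intro!: sum.cong)
  have "vec n (($) v) = v" if "v \<in> carrier_vec n" for v :: "complex vec"
    using that by auto
  then show ?thesis
    unfolding psd_def pos_form_def form [symmetric] using True
    by (metis vec_carrier)
qed (simp add: psd_def)

text \<open>Vectors supported on two coordinates see only a 2 by 2 principal submatrix, which is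
  enough for hermiticity and for the effect of a zero on the diagonal.\<close>

lemma qform_pair:
  assumes "i < n" "j < n" "i \<noteq> j"
  shows "qform n A (\<lambda>k. if k = i then x else if k = j then y else 0) =
    A i i * x * cnj x + A i j * y * cnj x + A j i * x * cnj y + A j j * y * cnj y"
proof -
  let ?v = "\<lambda>k. if k = i then x else if k = j then y else 0"
  have *: "(\<Sum>k<n. g k) = g i + g j" if "\<And>k. k \<noteq> i \<Longrightarrow> k \<noteq> j \<Longrightarrow> g k = 0"
    for g :: "nat \<Rightarrow> complex"
  proof -
    have "(\<Sum>k<n. g k) = (\<Sum>k\<in>{i, j}. g k)"
      by (rule sum.mono_neutral_right) (use assms that in auto)
    then show ?thesis using assms by simp
  qed
  show ?thesis
    unfolding qform_def
    by (subst *, simp, subst (1 2) *, simp, simp) (use assms in simp)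
qed

lemma qform_Suc:
  "qform (Suc n) A v = qform n A v + (\<Sum>i<n. A i n * cnj (v i)) * v n
    + (\<Sum>j<n. A n j * v j) * cnj (v n) + A n n * v n * cnj (v n)"
  by (simp add: qform_def sum.distrib sum_distrib_left sum_distrib_right mult_ac add_ac)

lemma pos_form_diag:
  assumes "pos_form n A" "i < n"
  shows "0 \<le> A i i"
proof -
  have single: "(\<Sum>k<n. g k) = g i" if "\<And>k. k \<noteq> i \<Longrightarrow> g k = 0" for g :: "nat \<Rightarrow> complex"
    using assms(2) that by (subst sum.mono_neutral_right [of _ "{i}"]) auto
  have "qform n A (\<lambda>k. if k = i then 1 else 0) = A i i"
    unfolding qform_def by (subst single, simp, subst single, simp, simp)
  then show ?thesis
    using assms(1) unfolding pos_form_def by metis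
qed

lemma pos_form_hermitian:
  assumes "pos_form n A" "i < n" "j < n"
  shows "A j i = cnj (A i j)"
proof (cases "i = j")
  case True
  then show ?thesis
    using pos_form_diag [OF assms(1,2)] by (simp add: complex_eq_iff less_eq_complex_def)
next
  case False
  have pos: "0 \<le> A i i * x * cnj x + A i j * y * cnj x + A j i * x * cnj y + A j j * y * cnj y"
    for x y
    using assms qform_pair [OF assms(2,3) False, of A x y] unfolding pos_form_def by metis
  \<comment> \<open>The diagonal terms are real, so \<open>x = y = 1\<close> forces
    \<open>A i j + A j i\<close> to be real, and \<open>x = 1\<close>, \<open>y = \<i>\<close> does
    the same for \<open>\<i> * (A i j - A j i)\<close>.\<close>
  show ?thesis
    using pos [of 1 1] pos [of 1 \<i>] pos_form_diag [OF assms(1,2)] pos_form_diag [OF assms(1,3)]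
    by (auto simp: complex_eq_iff less_eq_complex_def)
qed

text \<open>When \<open>A j j = 0\<close> and coordinate \<open>i\<close> is fixed at 1, the form is
  real-affine in coordinate \<open>j\<close>; a nonzero slope would make it negative far
  out.\<close>

lemma pos_form_zero_diag:
  assumes "pos_form n A" "i < n" "j < n" "A j j = 0"
  shows "A i j = 0"
proof (rule ccontr)
  assume nz: "A i j \<noteq> 0"
  then have ij: "i \<noteq> j"
    using assms by auto
  define a where "a = Re (A i i)"
  define c where "c = (cmod (A i j))\<^sup>2"
  \<comment> \<open>Chosen so that \<open>t * c\<close> exceeds \<open>\<bar>a\<bar>\<close>, which
    makes \<open>a - 2 * t * c\<close> negative.\<close>
  define t where "t = (\<bar>a\<bar> + 1) / c"
  have c: "c > 0" "complex_of_real c = A i j * cnj (A i j)"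
    using nz complex_norm_square [of "A i j"] by (simp_all add: c_def)
  have a: "A i i = complex_of_real a"
    using pos_form_diag [OF assms(1,2)]
    by (simp add: a_def complex_eq_iff less_eq_complex_def)
  have "0 \<le> A i i * 1 * cnj 1 + A i j * (- of_real t * cnj (A i j)) * cnj 1
      + A j i * 1 * cnj (- of_real t * cnj (A i j))
      + A j j * (- of_real t * cnj (A i j)) * cnj (- of_real t * cnj (A i j))"
    using assms qform_pair [OF assms(2,3) ij, of A] unfolding pos_form_def by metis
  also have "\<dots> = complex_of_real (a - 2 * t * c)"
    using assms(4) pos_form_hermitian [OF assms(1-3)]
    by (simp add: a c(2) algebra_simps)
  finally have "0 \<le> a - 2 * t * c"
    by (simp add: less_eq_complex_def)
  moreover have "t * c = \<bar>a\<bar> + 1"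
    using c by (simp add: t_def)
  ultimately show False
    by linarith
qed

text \<open>Completing the square: minimising over the last coordinate leaves the form of the Schur
  complement. If \<open>A n n = 0\<close>, division by zero yields zero and the complement is the
  leading block itself.\<close>

lemma pos_form_schur_complement:
  assumes "pos_form (Suc n) A"
  shows "pos_form n (\<lambda>i j. A i j - A i n * A n j / A n n)"
  unfolding pos_form_def
proof
  fix v :: "nat \<Rightarrow> complex"
  define d where "d = A n n"
  define s where "s = (\<Sum>j<n. A n j * v j)"
  \<comment> \<open>The minimising last coordinate for fixed \<open>v\<close>; it is
    \<open>0\<close> when \<open>d = 0\<close>.\<close>
  define w where "w = v(n := - s / d)"
  have zero: "s = 0" if "d = 0"
  proof -
    have "A n j = 0" if "j < n" for j
      using pos_form_zero_diag [OF assms, of j n] pos_form_hermitian [OF assms, of j n] \<open>d = 0\<close> that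
      by (simp add: d_def)
    then show ?thesis by (simp add: s_def)
  qed
  have d: "cnj d = d"
    using pos_form_hermitian [OF assms, of n n] by (simp add: d_def)
  have s: "(\<Sum>i<n. A i n * cnj (v i)) = cnj s"
    unfolding s_def cnj_sum
    by (rule sum.cong) (use pos_form_hermitian [OF assms, of n] in auto)
  have "qform (Suc n) A w = qform n A v + cnj s * w n + s * cnj (w n) + d * w n * cnj (w n)"
    unfolding qform_Suc s [symmetric] by (simp add: qform_def w_def d_def s_def)
  also have "\<dots> = qform n A v - s * cnj s / d"
    unfolding w_def using zero d by (cases "d = 0") (simp_all add: field_simps)
  also have "s * cnj s / d = (\<Sum>i<n. \<Sum>j<n. A i n * A n j / d * v j * cnj (v i))"
    unfolding s [symmetric] unfolding s_def sum_product sum_divide_distrib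
    by (subst sum.swap) (simp add: algebra_simps)
  also have "qform n A v - \<dots> = qform n (\<lambda>i j. A i j - A i n * A n j / A n n) v"
    by (simp add: qform_def d_def sum_subtractf [symmetric] algebra_simps)
  finally show "0 \<le> qform n (\<lambda>i j. A i j - A i n * A n j / A n n) v"
    using assms unfolding pos_form_def by metis
qed

text \<open>The rank-one part of \<open>A\<close> contributes a value of the form of
  \<open>B\<close>; the remainder lives on the leading block. The induction keeps \<open>A\<close>
  arbitrary because its Schur complement takes its place.\<close>

lemma pos_form_trace_mult_nonneg:
  assumes "pos_form n A" "pos_form n B"
  shows "0 \<le> (\<Sum>i<n. \<Sum>j<n. A i j * B j i)"
  using assms
proof (induction n arbitrary: A)
  case 0
  then show ?case by simp
next
  case (Suc n)
  define d where "d = A n n"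
  define A' where "A' = (\<lambda>i j. A i j - A i n * A n j / d)"
  have d: "0 \<le> d"
    using pos_form_diag [OF Suc.prems(1)] by (simp add: d_def)
  have zero: "A n j = 0" "A j n = 0" if "d = 0" "j < Suc n" for j
    using pos_form_zero_diag [OF Suc.prems(1), of j n]
      pos_form_hermitian [OF Suc.prems(1), of j n] that
    by (simp_all add: d_def)
  \<comment> \<open>For \<open>d \<noteq> 0\<close> the subtraction cancels the last row and column;
    for \<open>d = 0\<close> it subtracts zero, and these entries of \<open>A\<close> vanish by
    \<open>zero\<close>.\<close>
  have border: "A' n j = 0" "A' j n = 0" if "j < Suc n" for j
    using zero [OF _ that] by (cases "d = 0"; simp add: A'_def flip: d_def)+
  have B: "pos_form n B"
    unfolding pos_form_def
  proof
    fix v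
    have "qform n B v = qform (Suc n) B (v(n := 0))"
      by (simp add: qform_def)
    then show "0 \<le> qform n B v"
      using Suc.prems(2) unfolding pos_form_def by metis
  qed
  have "0 \<le> (\<Sum>i<n. \<Sum>j<n. A' i j * B j i)"
    using Suc.IH [OF _ B] pos_form_schur_complement [OF Suc.prems(1)]
    unfolding A'_def d_def by blast
  moreover have "(\<Sum>i<n. \<Sum>j<n. A' i j * B j i) = (\<Sum>i<Suc n. \<Sum>j<Suc n. A' i j * B j i)"
    by (simp add: border)
  moreover have "0 \<le> qform (Suc n) B (\<lambda>i. A i n) / d"
  proof -
    obtain r where "d = complex_of_real r" "0 \<le> r"
      using d that [of "Re d"] by (simp add: less_eq_complex_def complex_eq_iff)
    moreover have "0 \<le> qform (Suc n) B (\<lambda>i. A i n)"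
      using Suc.prems(2) unfolding pos_form_def by blast
    ultimately show ?thesis
      by (simp add: less_eq_complex_def)
  qed
  \<comment> \<open>Hermiticity turns the conjugated last column of \<open>A\<close> into its last
    row, so this form value is the pairing of \<open>B\<close> with the rank-one part.\<close>
  moreover have "qform (Suc n) B (\<lambda>i. A i n) / d =
      (\<Sum>i<Suc n. \<Sum>j<Suc n. A i n * A n j / d * B j i)"
  proof -
    have cnj_A: "cnj (A j n) = A n j" if "j < Suc n" for j
      using pos_form_hermitian [OF Suc.prems(1), of j n] that by simp
    have "qform (Suc n) B (\<lambda>i. A i n) = (\<Sum>j<Suc n. \<Sum>i<Suc n. A i n * A n j * B j i)"
      unfolding qform_def
      by (intro sum.cong refl) (simp add: cnj_A mult_ac)
    then show ?thesis
      by (subst sum.swap) (simp add: sum_divide_distrib del: sum.lessThan_Suc)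
  qed
  moreover have "(\<Sum>i<Suc n. \<Sum>j<Suc n. A i j * B j i) =
      (\<Sum>i<Suc n. \<Sum>j<Suc n. A' i j * B j i) + (\<Sum>i<Suc n. \<Sum>j<Suc n. A i n * A n j / d * B j i)"
    unfolding sum.distrib [symmetric] A'_def by (intro sum.cong refl) (simp add: algebra_simps)
  ultimately show ?case
    by (simp only: add_nonneg_nonneg)
qed

section \<open>Trace and scaling of positive semidefinite matrices\<close>

lemma psd_trace_nonneg:
  assumes "psd n A"
  shows "0 \<le> mat_trace A"
  using assms pos_form_diag [of n "\<lambda>i j. A $$ (i, j)"]
  unfolding psd_iff_pos_form mat_trace_def by (auto intro!: sum_nonneg)

text \<open>Nonnegative diagonal entries with sum zero all vanish, and a zero on the diagonal clears
  its column. This disposes of outcomes of probability zero.\<close>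

lemma psd_trace_zero:
  assumes "psd n A" "mat_trace A = 0"
  shows "A = 0\<^sub>m n n"
proof -
  have A: "A \<in> carrier_mat n n" and pos: "pos_form n (\<lambda>i j. A $$ (i, j))"
    using assms(1) by (auto simp: psd_iff_pos_form)
  have "(\<Sum>i<n. A $$ (i, i)) = 0"
    using assms(2) A by (simp add: mat_trace_def)
  then have "A $$ (i, i) = 0" if "i < n" for i
    using that pos_form_diag [OF pos] by (subst (asm) sum_nonneg_eq_0_iff) auto
  then show ?thesis
    using A pos_form_zero_diag [OF pos] by auto
qed

lemma psd_smult:
  assumes "psd n A" "0 \<le> c"
  shows "psd n (complex_of_real c \<cdot>\<^sub>m A)"
proof -
  have A: "A \<in> carrier_mat n n"
    using assms(1) by (simp add: psd_def)
  then have "qform n (\<lambda>i j. (complex_of_real c \<cdot>\<^sub>m A) $$ (i, j)) v =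
      complex_of_real c * qform n (\<lambda>i j. A $$ (i, j)) v" for v
    by (simp add: qform_def sum_distrib_left mult.assoc)
  then show ?thesis
    using assms A unfolding psd_iff_pos_form pos_form_def by (simp add: less_eq_complex_def)
qed

section \<open>Local operators and partial traces\<close>

lemma sum_prod_index:
  fixes f :: "nat \<Rightarrow> 'a::comm_monoid_add"
  shows "(\<Sum>x<m * n. f x) = (\<Sum>i<m. \<Sum>k<n. f (i * n + k))"
proof -
  have "sum f {i * n..<i * n + n} = (\<Sum>k<n. f (i * n + k))" for i
    using sum.shift_bounds_nat_ivl [of f 0 "i * n" n]
    by (simp add: atLeast0LessThan add.commute)
  then show ?thesis
    using sum.nat_group [of f n m] by simp
qed

lemma prod_index_less:
  fixes i k m n :: nat
  assumes "i < m" "k < n"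
  shows "i * n + k < m * n"
proof -
  have "i * n + k < Suc i * n" using assms by simp
  also have "\<dots> \<le> m * n" using assms by (intro mult_right_mono) auto
  finally show ?thesis .
qed

lemma trace_a_carrier [simp]: "trace_a m n X \<in> carrier_mat n n"
  by (simp add: trace_a_def)

text \<open>The identity factor keeps only the terms with \<open>b\<close>-index \<open>k\<close>.
  For fixed \<open>k\<close> and \<open>l\<close> the result is the trace of \<open>Q\<close> times
  an \<open>m\<close> by \<open>m\<close> submatrix of \<open>R\<close>.\<close>

lemma trace_a_local_index:
  assumes Q: "Q \<in> carrier_mat m m" and R: "R \<in> carrier_mat (m * n) (m * n)"
    and kl: "k < n" "l < n"
  shows "trace_a m n (kron Q (1\<^sub>m n) * R) $$ (k, l) =
    (\<Sum>i<m. \<Sum>j<m. Q $$ (i, j) * R $$ (j * n + k, i * n + l))"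
proof -
  have "(kron Q (1\<^sub>m n) * R) $$ (i * n + k, i * n + l) =
      (\<Sum>j<m. Q $$ (i, j) * R $$ (j * n + k, i * n + l))" if i: "i < m" for i
  proof -
    have "(kron Q (1\<^sub>m n) * R) $$ (i * n + k, i * n + l) =
        (\<Sum>x<m * n. kron Q (1\<^sub>m n) $$ (i * n + k, x) * R $$ (x, i * n + l))"
      using Q R prod_index_less [OF i kl(1)] prod_index_less [OF i kl(2)]
      by (simp add: kron_def scalar_prod_def atLeast0LessThan)
    also have "\<dots> = (\<Sum>j<m. \<Sum>k'<n. if k = k' then Q $$ (i, j) * R $$ (j * n + k', i * n + l) else 0)"
      unfolding sum_prod_index
      using Q prod_index_less [OF i kl(1)] prod_index_less [of _ m _ n] kl
      by (intro sum.cong refl) (auto simp: kron_def)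
    finally show ?thesis
      using kl by (simp add: sum.delta')
  qed
  then show ?thesis
    using kl by (simp add: trace_a_def)
qed

text \<open>For fixed \<open>v\<close>, the form of the reduced operator at \<open>v\<close> is the
  trace of \<open>Q\<close> times the compression of \<open>R\<close> by \<open>v\<close> on system
  \<open>b\<close>, and both factors are positive.\<close>

lemma psd_trace_a_local:
  assumes Q: "psd m Q" and R: "psd (m * n) R"
  shows "psd n (trace_a m n (kron Q (1\<^sub>m n) * R))"
  unfolding psd_iff_pos_form pos_form_def
proof (intro conjI allI)
  fix v :: "nat \<Rightarrow> complex"
  have Q': "Q \<in> carrier_mat m m" "pos_form m (\<lambda>i j. Q $$ (i, j))"
    and R': "R \<in> carrier_mat (m * n) (m * n)" "pos_form (m * n) (\<lambda>i j. R $$ (i, j))"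
    using Q R by (auto simp: psd_iff_pos_form)
  \<comment> \<open>The compression: \<open>B j i\<close> is the matrix element of \<open>R\<close>
    between e_j \<otimes> v and e_i \<otimes> v.\<close>
  define B where
    "B = (\<lambda>j i. \<Sum>k<n. \<Sum>l<n. R $$ (j * n + k, i * n + l) * v l * cnj (v k))"
  have "pos_form m B"
    unfolding pos_form_def
  proof
    fix u :: "nat \<Rightarrow> complex"
    \<comment> \<open>The form of \<open>B\<close> at \<open>u\<close> is that of \<open>R\<close>
      at the product vector u \<otimes> v.\<close>
    have "qform (m * n) (\<lambda>i j. R $$ (i, j)) (\<lambda>x. u (x div n) * v (x mod n)) =
        (\<Sum>j<m. \<Sum>k<n. \<Sum>i<m. \<Sum>l<n.
          R $$ (j * n + k, i * n + l) * (u i * v l) * cnj (u j * v k))"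
      unfolding qform_def sum_prod_index by (intro sum.cong refl) auto
    also have "\<dots> = qform m B u"
      unfolding qform_def B_def sum_distrib_right
      by (rule sum.cong [OF refl], subst sum.swap) (simp add: mult_ac)
    finally show "0 \<le> qform m B u"
      using R'(2) unfolding pos_form_def by metis
  qed
  then have "0 \<le> (\<Sum>i<m. \<Sum>j<m. Q $$ (i, j) * B j i)"
    by (rule pos_form_trace_mult_nonneg [OF Q'(2)])
  \<comment> \<open>From here on, finite sums are interchanged to bring \<open>k\<close> and
    \<open>l\<close> outermost.\<close>
  also have "(\<Sum>i<m. \<Sum>j<m. Q $$ (i, j) * B j i) =
      (\<Sum>i<m. \<Sum>j<m. \<Sum>k<n. \<Sum>l<n. Q $$ (i, j) * R $$ (j * n + k, i * n + l) * v l * cnj (v k))"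
    by (simp add: B_def sum_distrib_left mult.assoc)
  also have "\<dots> =
      (\<Sum>i<m. \<Sum>k<n. \<Sum>j<m. \<Sum>l<n. Q $$ (i, j) * R $$ (j * n + k, i * n + l) * v l * cnj (v k))"
    by (intro sum.cong refl sum.swap)
  also have "\<dots> =
      (\<Sum>k<n. \<Sum>i<m. \<Sum>l<n. \<Sum>j<m. Q $$ (i, j) * R $$ (j * n + k, i * n + l) * v l * cnj (v k))"
    by (subst sum.swap) (intro sum.cong refl sum.swap)
  also have "\<dots> =
      (\<Sum>k<n. \<Sum>l<n. \<Sum>i<m. \<Sum>j<m. Q $$ (i, j) * R $$ (j * n + k, i * n + l) * v l * cnj (v k))"
    by (intro sum.cong refl sum.swap)
  also have "\<dots> = qform n (\<lambda>k l. trace_a m n (kron Q (1\<^sub>m n) * R) $$ (k, l)) v"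
    unfolding qform_def
    by (intro sum.cong refl)
      (simp add: trace_a_local_index [OF Q'(1) R'(1)] sum_distrib_right)
  finally show "0 \<le> qform n (\<lambda>k l. trace_a m n (kron Q (1\<^sub>m n) * R) $$ (k, l)) v" .
qed simp

text \<open>Links the two data of an outcome: its probability is defined from the reduced state on
  \<open>a\<close>, its post-measurement operator from the full state. Both traces expand to one
  triple sum.\<close>

lemma mat_trace_trace_a_local:
  assumes Q: "Q \<in> carrier_mat m m" and R: "R \<in> carrier_mat (m * n) (m * n)"
  shows "mat_trace (trace_a m n (kron Q (1\<^sub>m n) * R)) = mat_trace (Q * trace_b m n R)"
proof -
  have "mat_trace (trace_a m n (kron Q (1\<^sub>m n) * R)) =
      (\<Sum>k<n. \<Sum>i<m. \<Sum>j<m. Q $$ (i, j) * R $$ (j * n + k, i * n + k))"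
    by (simp add: mat_trace_def carrier_matD [OF trace_a_carrier] trace_a_local_index [OF Q R])
  also have "\<dots> = (\<Sum>i<m. \<Sum>j<m. \<Sum>k<n. Q $$ (i, j) * R $$ (j * n + k, i * n + k))"
    by (subst sum.swap) (intro sum.cong refl sum.swap)
  also have "\<dots> = mat_trace (Q * trace_b m n R)"
    using Q by (simp add: mat_trace_def trace_b_def scalar_prod_def atLeast0LessThan
        sum_distrib_left)
  finally show ?thesis .
qed

lemma mat_trace_trace_a:
  assumes "R \<in> carrier_mat (m * n) (m * n)"
  shows "mat_trace (trace_a m n R) = mat_trace R"
  using assms by (simp add: mat_trace_def trace_a_def sum_prod_index) (rule sum.swap)

text \<open>Each entry is linear in \<open>P x\<close>, so summing over outcomes puts the identity
  in its place. Physically, an unrecorded measurement on \<open>a\<close> does not disturb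
  \<open>b\<close>.\<close>

lemma povm_sum_trace_a:
  assumes P: "povm m N P" and R: "R \<in> carrier_mat (m * n) (m * n)"
  shows "mat_sum n (\<lambda>x. trace_a m n (kron (P x) (1\<^sub>m n) * R)) {..<N} = trace_a m n R"
proof (rule eq_matI)
  fix k l assume "k < dim_row (trace_a m n R)" "l < dim_col (trace_a m n R)"
  then have kl: "k < n" "l < n" by (simp_all add: trace_a_def)
  have P': "P x \<in> carrier_mat m m" if "x < N" for x
    using P that by (simp add: povm_def psd_def)
  have one: "(\<Sum>x<N. P x $$ (i, j)) = (if i = j then 1 else 0)" if "i < m" "j < m" for i j
  proof -
    have "(\<Sum>x<N. P x $$ (i, j)) = mat_sum m P {..<N} $$ (i, j)"
      using that by (simp add: mat_sum_def)
    then show ?thesis using P that by (simp add: povm_def)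
  qed
  have "mat_sum n (\<lambda>x. trace_a m n (kron (P x) (1\<^sub>m n) * R)) {..<N} $$ (k, l) =
      (\<Sum>x<N. \<Sum>i<m. \<Sum>j<m. P x $$ (i, j) * R $$ (j * n + k, i * n + l))"
    using kl P' R by (simp add: mat_sum_def trace_a_local_index)
  also have "\<dots> = (\<Sum>i<m. \<Sum>j<m. \<Sum>x<N. P x $$ (i, j) * R $$ (j * n + k, i * n + l))"
    by (subst sum.swap) (intro sum.cong refl sum.swap)
  also have "\<dots> = (\<Sum>i<m. \<Sum>j<m. if i = j then R $$ (j * n + k, i * n + l) else 0)"
    by (intro sum.cong refl) (simp add: sum_distrib_right [symmetric] one)
  also have "\<dots> = trace_a m n R $$ (k, l)"
    using kl by (simp add: trace_a_def sum.delta')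
  finally show "mat_sum n (\<lambda>x. trace_a m n (kron (P x) (1\<^sub>m n) * R)) {..<N} $$ (k, l) =
    trace_a m n R $$ (k, l)" .
qed (simp_all add: mat_sum_def trace_a_def)

section \<open>Nonnegativity of the Holevo quantity\<close>

lemma mat_trace_mat_sum:
  assumes "\<And>x. x \<in> J \<Longrightarrow> A x \<in> carrier_mat n n"
  shows "mat_trace (mat_sum n A J) = (\<Sum>x\<in>J. mat_trace (A x))"
proof -
  have "mat_trace (mat_sum n A J) = (\<Sum>x\<in>J. \<Sum>i<n. A x $$ (i, i))"
    by (simp add: mat_trace_def mat_sum_def) (rule sum.swap)
  also have "\<dots> = (\<Sum>x\<in>J. mat_trace (A x))"
    by (intro sum.cong refl) (simp add: mat_trace_def carrier_matD [OF assms])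
  finally show ?thesis .
qed

text \<open>The post-measurement states, weighted by their probabilities, average to
  \<open>trace_a m n R\<close>, so the Holevo quantity is a concavity gap.\<close>

lemma holevo_nonneg:
  assumes S: "concave_entropy S" and dens: "density_op (m * n) R" and P: "povm m N P"
  shows "0 \<le> holevo S m n R N P"
proof -
  define T where "T = (\<lambda>x. trace_a m n (kron (P x) (1\<^sub>m n) * R))"
  define p where "p = (\<lambda>x. outcome_prob m n R (P x))"
  have psdR: "psd (m * n) R" and R: "R \<in> carrier_mat (m * n) (m * n)"
    and trR: "mat_trace R = 1"
    using dens by (auto simp: density_op_def psd_def)
  have psdP: "psd m (P x)" and PC: "P x \<in> carrier_mat m m" if "x < N" for x
    using P that by (auto simp: povm_def psd_def)
  have psdT: "psd n (T x)" if "x < N" for x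
    unfolding T_def by (rule psd_trace_a_local [OF psdP [OF that] psdR])
  have TC [simp]: "T x \<in> carrier_mat n n" for x
    by (simp add: T_def)
  \<comment> \<open>Nonnegativity in the complex order makes the trace real, so the real part in
    \<open>outcome_prob\<close> loses nothing.\<close>
  have trT: "mat_trace (T x) = complex_of_real (p x)" and p_nonneg: "0 \<le> p x" if "x < N" for x
  proof -
    have "0 \<le> mat_trace (T x)"
      by (rule psd_trace_nonneg [OF psdT [OF that]])
    moreover have "p x = Re (mat_trace (T x))"
      using PC [OF that] R by (simp add: p_def outcome_prob_def T_def mat_trace_trace_a_local)
    ultimately show "mat_trace (T x) = complex_of_real (p x)" "0 \<le> p x"
      by (simp_all add: less_eq_complex_def complex_eq_iff)
  qed
  have sumT: "mat_sum n T {..<N} = trace_a m n R"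
    unfolding T_def by (rule povm_sum_trace_a [OF P R])
  have "complex_of_real (\<Sum>x<N. p x) = mat_trace (mat_sum n T {..<N})"
    by (simp add: mat_trace_mat_sum trT)
  then have sum_p: "(\<Sum>x<N. p x) = 1"
    using sumT R trR by (simp add: mat_trace_trace_a flip: of_real_sum)
  have post: "density_op n (post_state m n R (P x))"
    and weighted: "complex_of_real (p x) \<cdot>\<^sub>m post_state m n R (P x) = T x"
    if "x < N" "p x \<noteq> 0" for x
  proof -
    have eq: "post_state m n R (P x) = complex_of_real (1 / p x) \<cdot>\<^sub>m T x"
      by (simp add: post_state_def p_def T_def)
    have "mat_trace (complex_of_real (1 / p x) \<cdot>\<^sub>m T x) = complex_of_real (1 / p x) * mat_trace (T x)"
      by (simp add: mat_trace_def sum_distrib_left carrier_matD [OF TC])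
    then show "density_op n (post_state m n R (P x))"
      unfolding eq density_op_def
      using psd_smult [OF psdT [OF that(1)], of "1 / p x"] p_nonneg [OF that(1)] trT [OF that(1)] that(2)
      by simp
    show "complex_of_real (p x) \<cdot>\<^sub>m post_state m n R (P x) = T x"
      unfolding eq using that(2) TC [of x] by (intro eq_matI) auto
  qed
  \<comment> \<open>Probabilities with sum 1 cannot all vanish.\<close>
  obtain y where y: "y < N" "p y \<noteq> 0"
    using sum_p by (metis lessThan_iff sum.neutral zero_neq_one)
  \<comment> \<open>Outcomes of probability \<open>0\<close> have no post-measurement state; any density operator may stand in.\<close>
  define \<sigma> where "\<sigma> = (\<lambda>x. post_state m n R (P (if p x = 0 then y else x)))"
  have "(\<Sum>x<N. p x * S (\<sigma> x)) \<le>
      S (mat_sum n (\<lambda>x. complex_of_real (p x) \<cdot>\<^sub>m \<sigma> x) {..<N})"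
    using S p_nonneg sum_p post y unfolding concave_entropy_def \<sigma>_def by simp
  also have "mat_sum n (\<lambda>x. complex_of_real (p x) \<cdot>\<^sub>m \<sigma> x) {..<N} = mat_sum n T {..<N}"
  proof -
    have "complex_of_real (p x) \<cdot>\<^sub>m \<sigma> x = T x" if "x < N" for x
    proof (cases "p x = 0")
      case True
      \<comment> \<open>A positive operator of trace zero is zero, so the stand-in, weighted by
        \<open>0\<close>, leaves the mixture unchanged.\<close>
      then have "T x = 0\<^sub>m n n"
        using psd_trace_zero [OF psdT [OF that]] trT [OF that] by simp
      moreover have "\<sigma> x \<in> carrier_mat n n"
        using post [OF y] True by (simp add: \<sigma>_def density_op_def psd_def)
      ultimately show ?thesis
        using True by (intro eq_matI) auto
    qed (simp add: \<sigma>_def weighted that)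
    then show ?thesis
      unfolding mat_sum_def by simp
  qed
  also have "(\<Sum>x<N. p x * S (\<sigma> x)) =
      (\<Sum>x | x < N \<and> p x \<noteq> 0. p x * S (post_state m n R (P x)))"
    by (rule sum.mono_neutral_cong_right) (auto simp: \<sigma>_def)
  finally show ?thesis
    by (simp add: holevo_def p_def sumT)
qed

section \<open>Subadditivity from firm subadditivity\<close>

text \<open>Firm subadditivity has to be applied to some POVM; this one exists in every dimension.
  The form of the identity is a sum of squared moduli.\<close>

lemma povm_trivial: "povm m 1 (\<lambda>_. 1\<^sub>m m)"
proof -
  have "qform m (\<lambda>i j. 1\<^sub>m m $$ (i, j)) v = (\<Sum>i<m. v i * cnj (v i))" for v
    unfolding qform_def
    by (rule sum.cong) (auto simp: if_distrib if_distribR cong: if_cong)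
  moreover have "0 \<le> (\<Sum>i<m. v i * cnj (v i))" for v :: "nat \<Rightarrow> complex"
    by (rule sum_nonneg) (simp add: complex_mult_cnj less_eq_complex_def)
  ultimately have "psd m (1\<^sub>m m)"
    by (simp add: psd_iff_pos_form pos_form_def)
  moreover have "mat_sum m (\<lambda>_. 1\<^sub>m m) {..<1::nat} = 1\<^sub>m m"
    by (intro eq_matI) (simp_all add: mat_sum_def)
  ultimately show ?thesis
    by (simp add: povm_def)
qed

theorem proposition1:
  fixes S :: "complex mat \<Rightarrow> real"
  assumes "entropy_function S" and "concave_entropy S"
  shows "(firmly_subadditive S \<longrightarrow> subadditive S)
    \<and> (subadditive S \<longleftrightarrow> (\<forall>m n \<rho>. density_op (m * n) \<rho> \<longrightarrow> mutual_info S m n \<rho> \<ge> 0))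
    \<and> (\<forall>m n \<rho> N P. density_op (m * n) \<rho> \<longrightarrow> povm m N P \<longrightarrow> holevo S m n \<rho> N P \<ge> 0)"
proof -
  have holevo: "0 \<le> holevo S m n \<rho> N P" if "density_op (m * n) \<rho>" "povm m N P" for m n \<rho> N P
    by (rule holevo_nonneg [OF assms(2) that])
  have iff: "subadditive S \<longleftrightarrow> (\<forall>m n \<rho>. density_op (m * n) \<rho> \<longrightarrow> mutual_info S m n \<rho> \<ge> 0)"
    unfolding subadditive_def mutual_info_def by simp
  \<comment> \<open>The Holevo quantity of the trivial measurement lies between zero and the mutual
    information.\<close>
  have "mutual_info S m n \<rho> \<ge> 0" if "firmly_subadditive S" "density_op (m * n) \<rho>" for m n \<rho>
    using holevo [OF that(2) povm_trivial] that povm_trivial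
    unfolding firmly_subadditive_def by (meson order_trans)
  with iff holevo show ?thesis
    by blast
qed

end
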